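(* Let $\lambda\in\mathbb{F}_{q^n}\setminus\mathbb{F}_q$ and let $t=[\mathbb{F}_q(\lambda):\mathbb{F}_q]$. Let $S=\langle 1,\lambda,\ldots,\lambda^{k-1}\rangle_{\mathbb{F}_q}$ with $1<k<t$, and let $\mathcal{C}=\mathrm{Orb}(S)$. If $k\le t/2$, then $$\omega_{2i}(\mathcal{C})=\begin{cases}(q+1)q^{2i-1} & \text{if } i\in\{1,\ldots,k-1\},\\ \dfrac{q^n-q^{2k-1}}{q-1} & \text{if } i=k.\end{cases}$$ If $k>t/2$, then $$\omega_{2i}(\mathcal{C})=\begin{cases}(q+1)q^{2i-1} & \text{if } i\in\{1,\ldots,t-k-1\},\\ \dfrac{q^t-q^{2(t-k)-1}}{q-1} & \text{if } i=t-k,\\ 0 & \text{if } i\in\{t-k+1,\ldots,k-1\}\text{ and } t-k+1\neq k,\\ \dfrac{q^n-q^t}{q-1} & \text{if } i=k.\end{cases}$$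
   Context: $q$ is a prime power. $\mathcal{G}_q(n,k)$ is the set of all $k$-dimensional $\mathbb{F}_q$-subspaces of $\mathbb{F}_{q^n}$, with distance $d(U,V)=2k-2\dim_{\mathbb{F}_q}(U\cap V)$. For $S\in\mathcal{G}_q(n,k)$, $\mathrm{Orb}(S)=\{\alpha S:\alpha\in\mathbb{F}_{q^n}^*\}$. For $\mathcal{C}=\mathrm{Orb}(S)$ and $i\in\{1,\dots,k\}$, $\omega_{2i}(\mathcal{C})=|\{\alpha S\in\mathrm{Orb}(S): \alpha\in\mathbb{F}_{q^n}^*,\ d(S,\alpha S)=2i\}|$ (number of subspaces in the orbit, not of elements $\alpha$). *)

theory Defs
  imports
    "HOL-Algebra.Finite_Extensions"
    "HOL-Algebra.Generated_Fields"
    "HOL-Number_Theory.Prime_Powers"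
begin

text \<open>
  The field with \<open>q ^ n\<close> elements is a field record \<open>R\<close> (HOL-Algebra) of order \<open>q ^ n\<close>, and
  the field with \<open>q\<close> elements is its subfield \<open>K\<close> of cardinality \<open>q\<close>. Subspaces are subsets
  of the carrier, and \<open>(ring.dim R over K) V\<close> is the \<open>K\<close>-dimension of \<open>V\<close>.
\<close>

text \<open>
  The distance on the \<open>k\<close>-dimensional \<open>K\<close>-subspaces of \<open>R\<close>; integer-valued, so that the
  subtraction is not truncated.
\<close>

definition subspace_dist ::
    "('a, 'b) ring_scheme \<Rightarrow> 'a set \<Rightarrow> nat \<Rightarrow> 'a set \<Rightarrow> 'a set \<Rightarrow> int" where
  "subspace_dist R K k U V = 2 * int k - 2 * int ((ring.dim R over K) (U \<inter> V))"

definition Orb :: "('a, 'b) ring_scheme \<Rightarrow> 'a set \<Rightarrow> 'a set set" where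
  "Orb R S = {\<alpha> <#\<^bsub>R\<^esub> S | \<alpha>. \<alpha> \<in> carrier R - {\<zero>\<^bsub>R\<^esub>}}"

text \<open>
  \<open>orbit_weight R K k S j\<close> is the number \<open>\<omega>\<^sub>j\<close> of the orbit of \<open>S\<close>: it counts the distinct
  subspaces in the orbit at distance \<open>j\<close> from \<open>S\<close>, not the multipliers producing them.
\<close>

definition orbit_weight ::
    "('a, 'b) ring_scheme \<Rightarrow> 'a set \<Rightarrow> nat \<Rightarrow> 'a set \<Rightarrow> nat \<Rightarrow> nat" where
  "orbit_weight R K k S j = card {V \<in> Orb R S. subspace_dist R K k S V = int j}"

end

theory Submission
  imports Defs
begin

text \<open>
  Let \<open>P m\<close> be the span of the first \<open>m\<close> powers of \<open>\<lambda>\<close>, and for a nonzero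
  \<open>\<alpha> \<in> K(\<lambda>)\<close> let \<open>w \<alpha> m\<close> be the dimension of \<open>W m = P m \<inter> \<alpha> P m\<close>. Both \<open>W m\<close> and
  \<open>\<lambda> W m\<close> lie in \<open>W (m + 1)\<close>, and they intersect in \<open>\<lambda> W (m - 1)\<close> as long as \<open>m < t\<close>; hence
  \<open>w \<alpha>\<close> is convex on \<open>{0..t}\<close>. As \<open>w \<alpha> 0 = 0\<close>, \<open>w \<alpha> t = t\<close> and \<open>w \<alpha> m \<ge> 2 m - t\<close>, its slopes
  run through 0, 1, 2, so \<open>w \<alpha> m = max 0 (m - d) (2 m - t)\<close> for a number \<open>d\<close> depending only on
  \<open>\<alpha>\<close>, its level.

  The levels are counted without any gcd argument: a pair of nonzero elements \<open>u, v\<close> of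
  \<open>P m\<close> is the same as an \<open>\<alpha> = u / v\<close> together with a nonzero \<open>u \<in> W m\<close>, so
  \<open>\<Sum>\<alpha>. (q ^ w \<alpha> m - 1) = (q ^ m - 1)\<^sup>2\<close>. Subtracting \<open>q\<close> times this identity at \<open>j\<close> from the one
  at \<open>j + 1\<close> leaves \<open>q - 1\<close> for every \<open>\<alpha>\<close> of level at most \<open>j\<close>, of which there are therefore
  \<open>q ^ (2 j + 1) - 1\<close> when \<open>2 (j + 1) \<le> t\<close>. The stabiliser of \<open>P k\<close> is the set of elements of
  level 0, of size \<open>q - 1\<close>, and multipliers outside \<open>K(\<lambda>)\<close> give trivial intersections.
\<close>

section \<open>Integer sequences and finite fibres\<close>

text \<open>Convexity makes the slopes \<open>s\<close> nondecreasing. From the last zero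
  \<open>d\<close> on they are at least 1, being integers, so \<open>w m\<close> is at least
  \<open>m - d\<close>. A strict excess at \<open>m\<close> needs an earlier slope of at least 2;
  then all later slopes are at least 2 as well, and the endpoint \<open>w t = t\<close> pushes
  \<open>w m\<close> down to \<open>2 * m - t\<close>.\<close>

lemma convex_profile:
  fixes w :: "nat \<Rightarrow> nat"
  assumes w0: "w 0 = 0" and wt: "w t = t"
    and convex: "\<And>m. Suc m < t \<Longrightarrow> 2 * w (Suc m) \<le> w (Suc (Suc m)) + w m"
    and lower: "\<And>m. m \<le> t \<Longrightarrow> 2 * m - t \<le> w m"
  shows "\<exists>d. \<forall>m\<le>t. w m = max (m - d) (2 * m - t)"
proof -
  define s where "s j = int (w (Suc j)) - int (w j)" for j
  have s_mono: "s i \<le> s j" if "i \<le> j" "j < t" for i j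
    using that
  proof (induction j rule: dec_induct)
    case (step j)
    then show ?case
      using convex[of j] by (simp add: s_def)
  qed simp
  have grow: "int (w i) + c * int (m - i) \<le> int (w m)" if "c \<le> s i" "i \<le> m" "m \<le> t" for c i m
    using that(2,3)
  proof (induction m rule: dec_induct)
    case (step m)
    then have "c \<le> s m"
      using s_mono[of i m] that(1) by simp
    with step show ?case
      by (simp add: s_def Suc_diff_le algebra_simps)
  qed simp
  have mono: "w i \<le> w m" if "i \<le> m" "m \<le> t" for i m
  proof (cases "i = m")
    case False
    then have "0 \<le> s i"
      using s_mono[of 0 i] that by (simp add: s_def w0)
    then show ?thesis
      using grow[of 0 i m] that by simp
  qed simp
  define d where "d = (GREATEST m. m \<le> t \<and> w m = 0)"
  have d: "d \<le> t \<and> w d = 0"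
    unfolding d_def by (rule GreatestI_nat[of _ 0 t]) (auto simp: w0)
  have pos: "w m > 0" if "d < m" "m \<le> t" for m
    using that Greatest_le_nat[of "\<lambda>m. m \<le> t \<and> w m = 0" m t] unfolding d_def by force
  have "w m = max (m - d) (2 * m - t)" if m: "m \<le> t" for m
  proof (cases "m \<le> d")
    case True
    then have "w m = 0"
      using mono[of m d] d by simp
    with True lower[OF m] show ?thesis
      by simp
  next
    case False
    then have "1 \<le> s d"
      using pos[of "Suc d"] d m by (simp add: s_def)
    then have ge: "m - d \<le> w m"
      using grow[of 1 d m] False m d by simp
    have "w m \<le> 2 * m - t" if gt: "m - d < w m"
    proof -
      have "\<exists>j. d \<le> j \<and> j < m \<and> 2 \<le> s j"
      proof (rule ccontr)
        assume "\<not> ?thesis"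
        then have small: "s j \<le> 1" if "d \<le> j" "j < m" for j
          using that by force
        have "w i \<le> i - d" if "d \<le> i" "i \<le> m" for i
          using that
        proof (induction i rule: dec_induct)
          case (step i)
          then show ?case
            using small[of i] by (simp add: s_def)
        qed (simp add: d)
        from this[of m] gt False show False
          by simp
      qed
      then obtain j where "d \<le> j" "j < m" "2 \<le> s j"
        by blast
      \<comment> \<open>Monotonicity of \<open>s\<close> is available only below \<open>t\<close>.
        At \<open>m = t\<close> the claim is just \<open>w t = t\<close>.\<close>
      then have "m < t \<Longrightarrow> 2 \<le> s m"
        using s_mono[of j m] by simp
      then have "m < t \<Longrightarrow> int (w m) + 2 * int (t - m) \<le> int t"
        using grow[of 2 m t] wt by simp
      then show ?thesis
        using m wt by (cases "m = t") auto
    qed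
    with ge lower[OF m] show ?thesis
      by (cases "m - d < w m") auto
  qed
  then show ?thesis
    by blast
qed

lemma card_eq_mult_card_image:
  assumes "finite A" and "\<And>y. y \<in> f ` A \<Longrightarrow> card {x \<in> A. f x = y} = c"
  shows "card A = c * card (f ` A)"
proof -
  have "card A = (\<Sum>x\<in>A. 1)"
    by simp
  also have "\<dots> = (\<Sum>y\<in>f ` A. \<Sum>x\<in>{x \<in> A. f x = y}. 1)"
    using assms(1) by (rule sum.image_gen)
  also have "\<dots> = (\<Sum>y\<in>f ` A. c)"
    using assms(2) by (intro sum.cong) auto
  finally show ?thesis
    by simp
qed

text \<open>The counts are made in \<open>nat\<close>, multiplied by \<open>q - 1\<close>. Here they
  become real quotients; \<open>b \<le> a\<close> rules out truncation.\<close>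

lemma real_eq_diff_divide:
  fixes x :: nat
  assumes "1 < q" and "(q - 1) * x = a - b" and "b \<le> a"
  shows "real x = (real a - real b) / (real q - 1)"
proof -
  have "(real q - 1) * real x = real ((q - 1) * x)"
    using assms(1) by (simp add: of_nat_diff)
  also have "\<dots> = real a - real b"
    using assms(2,3) by (simp add: of_nat_diff)
  finally show ?thesis
    using assms(1) by (simp add: field_simps)
qed

section \<open>Dimensions of subspaces and of their multiples\<close>

context ring
begin

declare Span.simps [simp del]

text \<open>Coordinates with respect to a basis: \<open>combine\<close> maps the scalar lists of
  length \<open>n\<close> bijectively onto \<open>V\<close>.\<close>

lemma card_dimension:
  assumes "subfield K R" and "finite K" and "dimension n K V"
  shows "card V = card K ^ n"
proof -
  obtain Us where Us: "set Us \<subseteq> carrier R" "independent K Us" "length Us = n" "Span K Us = V"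
    using exists_base[OF assms(1,3)] by blast
  have "bij_betw (\<lambda>Ks. combine Ks Us) {Ks. set Ks \<subseteq> K \<and> length Ks = n} V"
    unfolding bij_betw_def
  proof
    show "(\<lambda>Ks. combine Ks Us) ` {Ks. set Ks \<subseteq> K \<and> length Ks = n} = V"
      unfolding Us(3,4)[symmetric] Span_eq_combine_set_length_version[OF assms(1) Us(1)] by blast
    then show "inj_on (\<lambda>Ks. combine Ks Us) {Ks. set Ks \<subseteq> K \<and> length Ks = n}"
      using unique_decomposition[OF assms(1) Us(2)] unfolding Us(3,4) inj_on_def by blast
  qed
  then show ?thesis
    using card_lists_length_eq[OF assms(2), of n] bij_betw_same_card by metis
qed

lemma dim_mono:
  assumes "subfield K R" and "finite_dimension K V" and "finite_dimension K U" and "U \<subseteq> V"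
  shows "(dim over K) U \<le> (dim over K) V"
proof -
  obtain Us where Us: "set Us \<subseteq> carrier R" "independent K Us" "length Us = (dim over K) U"
      "Span K Us = U"
    using exists_base[OF assms(1) finite_dimensionE[OF assms(1,3)]] by blast
  then have "set Us \<subseteq> V"
    using Span_base_incl[OF assms(1) Us(1)] assms(4) by blast
  then show ?thesis
    using independent_length_le_dimension[OF assms(1) finite_dimensionE[OF assms(1,2)] Us(2)] Us(3)
    by simp
qed

lemma finite_dimension_inter:
  assumes "subfield K R" and "finite_dimension K U" and "finite_dimension K V"
  shows "finite_dimension K (U \<inter> V)"
  using subalbegra_incl_imp_finite_dimension[OF assms(1,2)
      subalgebra_inter[OF assms(2,3)[THEN finite_dimension_imp_subalgebra[OF assms(1)]]]]
  by simp

lemma set_add_subset: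
  assumes "subalgebra K W R" and "U \<subseteq> W" and "V \<subseteq> W"
  shows "U <+>\<^bsub>R\<^esub> V \<subseteq> W"
  using assms(2,3) subgroup.m_closed[OF subalgebra.axioms(1)[OF assms(1)]]
  unfolding set_add_def' by auto

text \<open>Grassmann's formula, with \<open>U + V\<close> inside \<open>W\<close>. It yields both
  the convexity of \<open>w \<alpha>\<close> and its lower bound.\<close>

lemma dim_add_dim_le:
  assumes "subfield K R" and "finite_dimension K U" and "finite_dimension K V"
    and "finite_dimension K W" and "U \<subseteq> W" and "V \<subseteq> W"
  shows "(dim over K) U + (dim over K) V \<le> (dim over K) W + (dim over K) (U \<inter> V)"
proof -
  have "U <+>\<^bsub>R\<^esub> V \<subseteq> W"
    using set_add_subset finite_dimension_imp_subalgebra[OF assms(1,4)] assms(5,6) by blast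
  then have "(dim over K) (U <+>\<^bsub>R\<^esub> V) \<le> (dim over K) W"
    using dim_mono[OF assms(1,4)] sum_space_dim(1)[OF assms(1-3)] by blast
  then show ?thesis
    using sum_space_dim(2)[OF assms(1-3)] by simp
qed

end

context field
begin

lemma mem_l_coset_iff:
  assumes "\<alpha> \<in> carrier R - {\<zero>}" and "V \<subseteq> carrier R" and "u \<in> carrier R"
  shows "u \<in> \<alpha> <#\<^bsub>R\<^esub> V \<longleftrightarrow> inv \<alpha> \<otimes> u \<in> V"
proof
  have inv: "inv \<alpha> \<in> carrier R" "inv \<alpha> \<otimes> \<alpha> = \<one>" "\<alpha> \<otimes> inv \<alpha> = \<one>"
    using assms(1) field_Units by auto
  {
    assume "u \<in> \<alpha> <#\<^bsub>R\<^esub> V"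
    then obtain v where "v \<in> V" "u = \<alpha> \<otimes> v"
      by (auto simp: l_coset_def)
    then show "inv \<alpha> \<otimes> u \<in> V"
      using inv assms by (metis DiffD1 l_one m_assoc subsetD)
  }
  assume "inv \<alpha> \<otimes> u \<in> V"
  moreover have "u = \<alpha> \<otimes> (inv \<alpha> \<otimes> u)"
    using inv assms by (metis DiffD1 l_one m_assoc)
  ultimately show "u \<in> \<alpha> <#\<^bsub>R\<^esub> V"
    by (auto simp: l_coset_def)
qed

lemma l_coset_line_extension:
  assumes "\<alpha> \<in> carrier R" and "K \<subseteq> carrier R" and "v \<in> carrier R" and "V \<subseteq> carrier R"
  shows "\<alpha> <#\<^bsub>R\<^esub> line_extension K v V = line_extension K (\<alpha> \<otimes> v) (\<alpha> <#\<^bsub>R\<^esub> V)"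
proof -
  have eq: "\<alpha> \<otimes> (k \<otimes> v \<oplus> u) = k \<otimes> (\<alpha> \<otimes> v) \<oplus> \<alpha> \<otimes> u" if "k \<in> K" "u \<in> V" for k u
  proof -
    have "k \<in> carrier R" "u \<in> carrier R"
      using that assms by auto
    then show ?thesis
      using assms(1,3) by (simp add: r_distr m_lcomm)
  qed
  show ?thesis
  proof (intro equalityI subsetI)
    fix x assume "x \<in> \<alpha> <#\<^bsub>R\<^esub> line_extension K v V"
    then obtain k u where ku: "k \<in> K" "u \<in> V" and x: "x = \<alpha> \<otimes> (k \<otimes> v \<oplus> u)"
      by (auto simp: l_coset_def line_extension_mem_iff)
    moreover have "\<alpha> \<otimes> u \<in> \<alpha> <#\<^bsub>R\<^esub> V"
      using ku by (auto simp: l_coset_def)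
    ultimately show "x \<in> line_extension K (\<alpha> \<otimes> v) (\<alpha> <#\<^bsub>R\<^esub> V)"
      unfolding line_extension_mem_iff x eq[OF ku] using ku by blast
  next
    fix x assume "x \<in> line_extension K (\<alpha> \<otimes> v) (\<alpha> <#\<^bsub>R\<^esub> V)"
    then obtain k u where ku: "k \<in> K" "u \<in> V" and x: "x = k \<otimes> (\<alpha> \<otimes> v) \<oplus> \<alpha> \<otimes> u"
      by (auto simp: l_coset_def line_extension_mem_iff)
    moreover have "k \<otimes> v \<oplus> u \<in> line_extension K v V"
      unfolding line_extension_mem_iff using ku by blast
    ultimately show "x \<in> \<alpha> <#\<^bsub>R\<^esub> line_extension K v V"
      unfolding l_coset_def x eq[OF ku, symmetric] by blast
  qed
qed

lemma l_coset_l_coset: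
  assumes "\<alpha> \<in> carrier R" and "\<beta> \<in> carrier R" and "V \<subseteq> carrier R"
  shows "\<alpha> <#\<^bsub>R\<^esub> (\<beta> <#\<^bsub>R\<^esub> V) = (\<alpha> \<otimes> \<beta>) <#\<^bsub>R\<^esub> V"
proof -
  have "\<alpha> \<otimes> (\<beta> \<otimes> v) = \<alpha> \<otimes> \<beta> \<otimes> v" if "v \<in> V" for v
    using assms that by (auto simp: m_assoc)
  then show ?thesis
    by (simp add: l_coset_def)
qed

text \<open>Induction along a chain of line extensions: multiplication by \<alpha> commutes with
  \<open>line_extension\<close> and, being invertible, keeps the new vector outside the smaller
  space.\<close>

lemma dimension_l_coset:
  assumes "subfield K R" and "\<alpha> \<in> carrier R - {\<zero>}" and "dimension n K V"
  shows "dimension n K (\<alpha> <#\<^bsub>R\<^esub> V)"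
  using assms(3)
proof (induction n arbitrary: V)
  case 0
  then have "V = {\<zero>}"
    using dimension_zero[OF assms(1)] by blast
  then show ?case
    using assms(2) by (simp add: l_coset_def)
next
  case (Suc n)
  then obtain v V' where v: "v \<in> carrier R" "dimension n K V'" "v \<notin> V'"
      "V = line_extension K v V'"
    using dimension_backwards[OF assms(1)] by blast
  have V': "V' \<subseteq> carrier R"
    using space_subgroup_props(1)[OF assms(1) v(2)] .
  have "inv \<alpha> \<otimes> (\<alpha> \<otimes> v) = v"
    using assms(2) v(1) field_Units by (metis DiffD1 Units_inv_closed Units_l_inv l_one m_assoc)
  then have "\<alpha> \<otimes> v \<notin> \<alpha> <#\<^bsub>R\<^esub> V'"
    using mem_l_coset_iff[OF assms(2) V'] assms(2) v by simp
  then show ?case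
    using Suc_dim[OF _ _ Suc.IH[OF v(2)]] l_coset_line_extension[OF _ subfieldE(3)[OF assms(1)] v(1) V']
      assms(2) v by simp
qed

lemma dim_l_coset:
  assumes "subfield K R" and "\<alpha> \<in> carrier R - {\<zero>}" and "finite_dimension K V"
  shows "finite_dimension K (\<alpha> <#\<^bsub>R\<^esub> V)" and "(dim over K) (\<alpha> <#\<^bsub>R\<^esub> V) = (dim over K) V"
proof -
  have dim: "dimension ((dim over K) V) K (\<alpha> <#\<^bsub>R\<^esub> V)"
    using dimension_l_coset[OF assms(1,2) finite_dimensionE[OF assms(1,3)]] .
  show "finite_dimension K (\<alpha> <#\<^bsub>R\<^esub> V)"
    using finite_dimensionI[OF dim] .
  show "(dim over K) (\<alpha> <#\<^bsub>R\<^esub> V) = (dim over K) V"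
    using dimI[OF assms(1) dim] .
qed

lemma l_coset_subfield:
  assumes "subfield F R" and "\<alpha> \<in> F - {\<zero>}"
  shows "\<alpha> <#\<^bsub>R\<^esub> F = F"
proof -
  have \<alpha>: "\<alpha> \<in> carrier R - {\<zero>}" and F: "F \<subseteq> carrier R"
    using assms subfieldE(3) by blast+
  have m_closed: "x \<otimes> y \<in> F" if "x \<in> F" "y \<in> F" for x y
    using that subringE(6)[OF subfieldE(1)[OF assms(1)]] by blast
  have "x \<in> \<alpha> <#\<^bsub>R\<^esub> F" if "x \<in> F" for x
    using mem_l_coset_iff[OF \<alpha> F] m_closed[OF _ that] subfield_m_inv(1)[OF assms] F that by blast
  moreover have "\<alpha> <#\<^bsub>R\<^esub> F \<subseteq> F"
    using m_closed assms(2) by (auto simp: l_coset_def)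
  ultimately show ?thesis
    by blast
qed

lemma l_coset_one: "V \<subseteq> carrier R \<Longrightarrow> \<one> <#\<^bsub>R\<^esub> V = V"
  by (simp add: l_coset_def subset_iff)

lemma inv_mult_Units:
  assumes "x \<in> Units R" and "y \<in> Units R"
  shows "inv (x \<otimes> y) = inv x \<otimes> inv y"
proof (rule comm_inv_char)
  have "x \<in> carrier R" "y \<in> carrier R" "inv x \<in> carrier R" "inv y \<in> carrier R"
    using assms by auto
  then show "x \<otimes> y \<otimes> (inv x \<otimes> inv y) = \<one>"
    using assms by (simp add: m_assoc m_lcomm[of y "inv x"])
qed (use assms in auto)

end

section \<open>The flag spanned by the powers of an element\<close>

locale power_flag = field R for R :: "('a, 'b) ring_scheme" (structure) +
  fixes K :: "'a set" and lam :: 'a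
  assumes subfield: "subfield K R"
    and finite_carrier: "finite (carrier R)"
    and lam: "lam \<in> carrier R - K"
begin

abbreviation E :: "'a set" where "E \<equiv> simple_extension K lam"

text \<open>The degree of the minimal polynomial, the form in which independence of the powers is
  known; the final proof identifies it with the degree of \<open>K(\<lambda>)\<close> over
  \<open>K\<close>.\<close>

definition t :: nat where "t = degree (Irr K lam)"

text \<open>\<open>exp_base\<close> lists the powers in decreasing order, so passing to
  \<open>Suc m\<close> puts the new power at the head and is a single
  \<open>line_extension\<close>.\<close>

definition P :: "nat \<Rightarrow> 'a set" where "P m = Span K (exp_base lam m)"

definition W :: "'a \<Rightarrow> nat \<Rightarrow> 'a set" where "W \<alpha> m = P m \<inter> (\<alpha> <#\<^bsub>R\<^esub> P m)"

definition w :: "'a \<Rightarrow> nat \<Rightarrow> nat" where "w \<alpha> m = (dim over K) (W \<alpha> m)"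

lemma K_sub: "K \<subseteq> carrier R" "\<zero> \<in> K" "\<one> \<in> K"
  using subfieldE(3)[OF subfield] subringE(2,3)[OF subfieldE(1)[OF subfield]] by auto

lemma lam_carrier: "lam \<in> carrier R" "lam \<in> carrier R - {\<zero>}"
  using lam K_sub by auto

lemma finite_K: "finite K"
  using K_sub(1) finite_carrier finite_subset by blast

lemma card_K_gt_1: "1 < card K"
proof -
  have "card {\<zero>, \<one>} \<le> card K"
    using K_sub finite_K by (intro card_mono) auto
  then show ?thesis
    by simp
qed

lemma finite_dimension_carrier: "finite_dimension K (carrier R)"
proof -
  obtain Us where Us: "set Us = carrier R"
    using finite_list[OF finite_carrier] by blast
  then have "Span K Us = carrier R"
    using Span_in_carrier[OF K_sub(1)] Span_base_incl[OF subfield, of Us] by blast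
  then show ?thesis
    using Span_finite_dimension[OF subfield, of Us] Us by simp
qed

lemma algebraic_lam: "(algebraic over K) lam"
  using finite_dimension_imp_algebraic[OF subfield carrier_is_subring finite_dimension_carrier]
    lam_carrier by blast

lemma subfield_E: "subfield E R"
  using simple_extension_is_subfield[OF subfield lam_carrier(1)] algebraic_lam by blast

lemma E_carrier: "E \<subseteq> carrier R"
  using subfieldE(3)[OF subfield_E] .

lemma finite_E: "finite E"
  using finite_subset[OF E_carrier finite_carrier] .

text \<open>Since \<lambda> is algebraic, its polynomial expressions already form a field.\<close>

lemma E_eq_generate_field: "E = generate_field R (insert lam K)"
proof (rule generate_fieldI)
  show "insert lam K \<subseteq> carrier R"
    using K_sub lam_carrier by blast
  show "subfield E R"
    by (rule subfield_E)
  show "insert lam K \<subseteq> E"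
    using simple_extension_mem[OF subfieldE(1)[OF subfield] lam_carrier(1)]
      simple_extension_incl[OF K_sub(1) lam_carrier(1)] by blast
  show "E \<subseteq> F" if "subfield F R" "insert lam K \<subseteq> F" for F
    using simple_extension_subring_incl[OF subfieldE(1)[OF that(1)]] that(2) by blast
qed

lemma independent_exp_base: "m \<le> t \<Longrightarrow> independent K (exp_base lam m)"
  using exp_base_append[of lam m "t - m"] independent_split(1)[OF subfield]
    exp_base_independent[OF subfield lam_carrier(1) algebraic_lam]
  by (metis le_add_diff_inverse t_def)

lemma P_0: "P 0 = {\<zero>}"
  by (simp add: P_def exp_base_def Span.simps)

lemma P_Suc: "P (Suc m) = line_extension K (lam [^] m) (P m)"
  by (simp add: P_def exp_base_def Span.simps)

lemma P_t: "P t = E"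
  unfolding P_def t_def using Span_exp_base[OF subfield lam_carrier(1) algebraic_lam] .

lemma subalgebra_P: "subalgebra K (P m) R"
  unfolding P_def using Span_is_subalgebra[OF subfield exp_base_closed[OF lam_carrier(1)]] .

lemma P_carrier: "P m \<subseteq> carrier R"
  using subalgebra_in_carrier[OF subalgebra_P] .

lemma zero_P: "\<zero> \<in> P m"
  using subgroup.one_closed[OF subalgebra.axioms(1)[OF subalgebra_P]] by simp

lemma dimension_P: "m \<le> t \<Longrightarrow> dimension m K (P m)"
  using dimensionI[OF subfield independent_exp_base, of m "P m"] by (simp add: P_def exp_base_def)

lemma finite_dimension_P: "finite_dimension K (P m)"
  unfolding P_def using Span_finite_dimension[OF subfield exp_base_closed[OF lam_carrier(1)]] .

lemma P_mono: "m \<le> n \<Longrightarrow> P m \<subseteq> P n"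
  unfolding P_def
  by (rule mono_Span_sublist[OF subfield _ exp_base_closed[OF lam_carrier(1)]])
    (auto simp: exp_base_def)

lemma lam_mult_P: "u \<in> P m \<Longrightarrow> lam \<otimes> u \<in> P (Suc m)"
proof (induction m arbitrary: u)
  case 0
  then show ?case
    using lam_carrier zero_P by (simp add: P_0)
next
  case (Suc m)
  then obtain k v where kv: "k \<in> K" "v \<in> P m" "u = k \<otimes> lam [^] m \<oplus> v"
    by (auto simp: P_Suc line_extension_mem_iff)
  then have "k \<in> carrier R" "v \<in> carrier R"
    using K_sub P_carrier by auto
  then have "lam \<otimes> u = k \<otimes> lam [^] Suc m \<oplus> lam \<otimes> v"
    using kv(3) lam_carrier by (simp add: r_distr m_lcomm m_comm)
  then show ?case
    using Suc.IH[OF kv(2)] kv(1) P_Suc[of "Suc m"] line_extension_mem_iff by blast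
qed

text \<open>Comparison of leading terms: if \<open>k\<close> is the coefficient of
  \<open>lam [^] m\<close> in \<open>u\<close>, then \<open>k \<otimes> lam [^] Suc m\<close> lies
  in \<open>P (Suc m)\<close>. As \<open>Suc m < t\<close>, this power is independent of the lower
  ones, so \<open>k = \<zero>\<close>.\<close>

lemma lam_mult_P_cancel:
  assumes "Suc m < t" and "u \<in> P (Suc m)" and "lam \<otimes> u \<in> P (Suc m)"
  shows "u \<in> P m"
proof -
  obtain k v where kv: "k \<in> K" "v \<in> P m" "u = k \<otimes> lam [^] m \<oplus> v"
    using assms(2) by (auto simp: P_Suc line_extension_mem_iff)
  have carr: "k \<in> carrier R" "v \<in> carrier R"
    using kv K_sub P_carrier by auto
  then have "lam \<otimes> u = k \<otimes> lam [^] Suc m \<oplus> lam \<otimes> v"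
    using kv(3) lam_carrier by (simp add: r_distr m_lcomm m_comm)
  then have "k \<otimes> lam [^] Suc m = lam \<otimes> u \<ominus> lam \<otimes> v"
    using carr lam_carrier by (simp add: minus_eq a_assoc r_neg)
  moreover have "lam \<otimes> u \<ominus> lam \<otimes> v \<in> P (Suc m)"
    using assms(3) lam_mult_P[OF kv(2)] space_subgroup_props(3,4)[OF subfield dimension_P] assms(1)
    by (simp add: minus_eq)
  ultimately have mem: "k \<otimes> lam [^] Suc m \<in> P (Suc m)"
    by simp
  have "independent K (lam [^] Suc m # exp_base lam (Suc m))"
    using independent_exp_base[of "Suc (Suc m)"] assms(1) by (simp add: exp_base_def)
  then have "lam [^] Suc m \<notin> P (Suc m)"
    unfolding P_def using independent_backwards(1) by blast
  then have "k = \<zero>"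
    using mem space_subgroup_props(6)[OF subfield dimension_P, of "Suc m" k "lam [^] Suc m"] kv(1)
      assms(1) lam_carrier by auto
  then show ?thesis
    using kv carr lam_carrier by simp
qed

section \<open>The dimension of \<open>W \<alpha> m\<close> as a function of
  \<open>m\<close>\<close>

lemma finite_dimension_W: "\<alpha> \<in> carrier R - {\<zero>} \<Longrightarrow> finite_dimension K (W \<alpha> m)"
  unfolding W_def
  using finite_dimension_inter[OF subfield finite_dimension_P] dim_l_coset(1)[OF subfield _ finite_dimension_P]
  by blast

lemma mem_W_iff: "u \<in> W \<alpha> m \<longleftrightarrow> u \<in> P m \<and> (\<exists>v\<in>P m. u = \<alpha> \<otimes> v)"
  by (auto simp: W_def l_coset_def)

text \<open>Grassmann's formula for \<open>W \<alpha> (Suc m)\<close> and its multiple by \<lambda>.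
  They have equal dimension, lie in \<open>W \<alpha> (Suc (Suc m))\<close>, and meet inside
  \<lambda> times \<open>W \<alpha> m\<close>.\<close>

lemma w_convex:
  assumes \<alpha>: "\<alpha> \<in> carrier R - {\<zero>}" and m: "Suc m < t"
  shows "2 * w \<alpha> (Suc m) \<le> w \<alpha> (Suc (Suc m)) + w \<alpha> m"
proof -
  let ?U = "W \<alpha> (Suc m)"
  have comm: "lam \<otimes> (\<alpha> \<otimes> v) = \<alpha> \<otimes> (lam \<otimes> v)" if "v \<in> P i" for v i
    using that \<alpha> lam_carrier P_carrier by (blast intro: m_lcomm)
  have "?U \<subseteq> W \<alpha> (Suc (Suc m))"
    using P_mono[of "Suc m" "Suc (Suc m)"] by (fastforce simp: mem_W_iff)
  moreover have "lam <#\<^bsub>R\<^esub> ?U \<subseteq> W \<alpha> (Suc (Suc m))"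
  proof
    fix x assume "x \<in> lam <#\<^bsub>R\<^esub> ?U"
    then obtain v where v: "v \<in> P (Suc m)" "\<alpha> \<otimes> v \<in> P (Suc m)" "x = lam \<otimes> (\<alpha> \<otimes> v)"
      by (auto simp: l_coset_def mem_W_iff)
    then show "x \<in> W \<alpha> (Suc (Suc m))"
      using lam_mult_P comm[OF v(1)] unfolding mem_W_iff by metis
  qed
  ultimately have "(dim over K) ?U + (dim over K) (lam <#\<^bsub>R\<^esub> ?U)
      \<le> (dim over K) (W \<alpha> (Suc (Suc m))) + (dim over K) (?U \<inter> (lam <#\<^bsub>R\<^esub> ?U))"
    using finite_dimension_W[OF \<alpha>] dim_l_coset(1)[OF subfield lam_carrier(2) finite_dimension_W[OF \<alpha>]]
    by (intro dim_add_dim_le[OF subfield])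
  moreover have "(dim over K) (lam <#\<^bsub>R\<^esub> ?U) = w \<alpha> (Suc m)"
    using dim_l_coset(2)[OF subfield lam_carrier(2) finite_dimension_W[OF \<alpha>]] by (simp add: w_def)
  moreover have "(dim over K) (?U \<inter> (lam <#\<^bsub>R\<^esub> ?U)) \<le> w \<alpha> m"
  proof -
    have "?U \<inter> (lam <#\<^bsub>R\<^esub> ?U) \<subseteq> lam <#\<^bsub>R\<^esub> W \<alpha> m"
    proof
      fix x assume "x \<in> ?U \<inter> (lam <#\<^bsub>R\<^esub> ?U)"
      then obtain v v' where v: "v \<in> P (Suc m)" "\<alpha> \<otimes> v \<in> P (Suc m)" "x = lam \<otimes> (\<alpha> \<otimes> v)"
        and v': "v' \<in> P (Suc m)" "x = \<alpha> \<otimes> v'" and x: "x \<in> P (Suc m)"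
        by (auto simp: l_coset_def mem_W_iff)
      \<comment> \<open>Cancelling \<alpha> puts \<open>lam \<otimes> v\<close> into
        \<open>P (Suc m)\<close>, and \<open>x = lam \<otimes> (\<alpha> \<otimes> v)\<close> lies
        there as well; so both \<open>v\<close> and \<open>\<alpha> \<otimes> v\<close> drop to
        \<open>P m\<close>.\<close>
      have "\<alpha> \<otimes> (lam \<otimes> v) = \<alpha> \<otimes> v'"
        using comm[OF v(1)] v(3) v'(2) by simp
      moreover have "lam \<otimes> v \<in> carrier R" "v' \<in> carrier R"
        using v(1) v'(1) lam_carrier P_carrier by blast+
      ultimately have "lam \<otimes> v = v'"
        using \<alpha> m_lcancel by blast
      then have "v \<in> P m"
        using lam_mult_P_cancel[OF m v(1)] v'(1) by simp
      moreover have "\<alpha> \<otimes> v \<in> P m"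
        using lam_mult_P_cancel[OF m v(2)] v(3) x by simp
      ultimately have "\<alpha> \<otimes> v \<in> W \<alpha> m"
        by (auto simp: mem_W_iff)
      then show "x \<in> lam <#\<^bsub>R\<^esub> W \<alpha> m"
        using v(3) by (auto simp: l_coset_def)
    qed
    then have "(dim over K) (?U \<inter> (lam <#\<^bsub>R\<^esub> ?U)) \<le> (dim over K) (lam <#\<^bsub>R\<^esub> W \<alpha> m)"
      using finite_dimension_W[OF \<alpha>] dim_l_coset(1)[OF subfield lam_carrier(2) finite_dimension_W[OF \<alpha>]]
      by (intro dim_mono[OF subfield] finite_dimension_inter[OF subfield])
    then show ?thesis
      using dim_l_coset(2)[OF subfield lam_carrier(2) finite_dimension_W[OF \<alpha>]] by (simp add: w_def)
  qed
  ultimately show ?thesis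
    by (simp add: w_def)
qed

lemma w_0: "\<alpha> \<in> carrier R - {\<zero>} \<Longrightarrow> w \<alpha> 0 = 0"
proof -
  assume "\<alpha> \<in> carrier R - {\<zero>}"
  then have "W \<alpha> 0 = {\<zero>}"
    by (auto simp: W_def P_0 l_coset_def)
  then show ?thesis
    unfolding w_def using dimI[OF subfield zero_dim] by simp
qed

lemma dim_P: "m \<le> t \<Longrightarrow> (dim over K) (P m) = m"
  using dimI[OF subfield dimension_P] .

lemma w_t: "\<alpha> \<in> E - {\<zero>} \<Longrightarrow> w \<alpha> t = t"
  using dim_P[of t] l_coset_subfield[OF subfield_E] by (simp add: w_def W_def P_t)

text \<open>Both \<open>P m\<close> and its multiple by \<alpha> lie in \<open>K(\<lambda>)\<close>,
  which has dimension \<open>t\<close> and is mapped onto itself by \<alpha>.\<close>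

lemma w_lower:
  assumes \<alpha>: "\<alpha> \<in> E - {\<zero>}" and m: "m \<le> t"
  shows "2 * m - t \<le> w \<alpha> m"
proof -
  have \<alpha>': "\<alpha> \<in> carrier R - {\<zero>}"
    using \<alpha> E_carrier by blast
  have "\<alpha> <#\<^bsub>R\<^esub> P m \<subseteq> \<alpha> <#\<^bsub>R\<^esub> P t"
    using P_mono[OF m] by (auto simp: l_coset_def)
  then have "\<alpha> <#\<^bsub>R\<^esub> P m \<subseteq> P t"
    using l_coset_subfield[OF subfield_E \<alpha>] by (simp add: P_t)
  then have "(dim over K) (P m) + (dim over K) (\<alpha> <#\<^bsub>R\<^esub> P m) \<le> (dim over K) (P t) + w \<alpha> m"
    unfolding w_def W_def
    using P_mono[OF m] finite_dimension_P dim_l_coset(1)[OF subfield \<alpha>' finite_dimension_P]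
    by (intro dim_add_dim_le[OF subfield])
  then show ?thesis
    using dim_l_coset(2)[OF subfield \<alpha>' finite_dimension_P] dim_P[of m] dim_P[of t] m by simp
qed

text \<open>A nonzero common element \<open>u = \<alpha> \<otimes> v\<close> would give
  \<open>\<alpha> = u \<otimes> inv v\<close>, an element of \<open>K(\<lambda>)\<close>.\<close>

lemma w_outside:
  assumes \<alpha>: "\<alpha> \<in> carrier R - E" and m: "m \<le> t"
  shows "w \<alpha> m = 0"
proof -
  have "u = \<zero>" if u: "u \<in> W \<alpha> m" for u
  proof (rule ccontr)
    assume "u \<noteq> \<zero>"
    obtain v where v: "v \<in> P m" "u = \<alpha> \<otimes> v" and "u \<in> P m"
      using u by (auto simp: mem_W_iff)
    then have E: "u \<in> E" "v \<in> E - {\<zero>}"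
      using P_mono[OF m] \<alpha> \<open>u \<noteq> \<zero>\<close> by (auto simp: P_t)
    then have "u \<otimes> inv v \<in> E"
      using subfield_m_inv(1)[OF subfield_E] subringE(6)[OF subfieldE(1)[OF subfield_E]] by blast
    moreover have "v \<in> Units R" "v \<in> carrier R"
      using E(2) E_carrier field_Units by auto
    then have "u \<otimes> inv v = \<alpha>"
      using v(2) \<alpha> by (simp add: m_assoc)
    ultimately show False
      using \<alpha> by blast
  qed
  moreover have "\<zero> \<in> W \<alpha> m"
    using \<alpha> zero_P by (force simp: mem_W_iff)
  ultimately have "W \<alpha> m = {\<zero>}"
    by blast
  then show ?thesis
    unfolding w_def using dimI[OF subfield zero_dim] by simp
qed

text \<open>A choice, because all \<open>d\<close> with \<open>2 * Suc d > t\<close> give the same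
  profile on \<open>{0..t}\<close>. Levels with \<open>2 * Suc d \<le> t\<close> are determined by
  the profile, and only in that range are they counted.\<close>

definition level :: "'a \<Rightarrow> nat" where
  "level \<alpha> = (SOME d. \<forall>m\<le>t. w \<alpha> m = max (m - d) (2 * m - t))"

lemma w_eq_level:
  assumes \<alpha>: "\<alpha> \<in> E - {\<zero>}" and m: "m \<le> t"
  shows "w \<alpha> m = max (m - level \<alpha>) (2 * m - t)"
proof -
  have \<alpha>': "\<alpha> \<in> carrier R - {\<zero>}"
    using \<alpha> E_carrier by blast
  have "\<exists>d. \<forall>m\<le>t. w \<alpha> m = max (m - d) (2 * m - t)"
    using convex_profile[of "w \<alpha>" t] w_0[OF \<alpha>'] w_t[OF \<alpha>] w_convex[OF \<alpha>'] w_lower[OF \<alpha>] by blast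
  from someI_ex[OF this] m show ?thesis
    unfolding level_def by blast
qed

section \<open>Distribution of the levels by double counting\<close>

lemma card_W: "\<alpha> \<in> carrier R - {\<zero>} \<Longrightarrow> card (W \<alpha> m) = card K ^ w \<alpha> m"
  unfolding w_def
  using card_dimension[OF subfield finite_K finite_dimensionE[OF subfield finite_dimension_W]] .

lemma sum_card_W:
  assumes "m \<le> t"
  shows "(\<Sum>\<alpha>\<in>E - {\<zero>}. card (W \<alpha> m) - 1) = (card K ^ m - 1)\<^sup>2"
proof -
  have fin: "finite (P m)"
    using finite_subset[OF P_carrier finite_carrier] .
  have zero_W: "\<zero> \<in> W \<alpha> m" if "\<alpha> \<in> carrier R" for \<alpha>
    using that zero_P by (force simp: mem_W_iff)
  have "(\<Sum>\<alpha>\<in>E - {\<zero>}. card (W \<alpha> m) - 1) = (\<Sum>\<alpha>\<in>E - {\<zero>}. card (W \<alpha> m - {\<zero>}))"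
    using zero_W E_carrier by (intro sum.cong refl card_Diff_singleton[symmetric]) auto
  also have "\<dots> = card (SIGMA \<alpha>:E - {\<zero>}. W \<alpha> m - {\<zero>})"
    using finite_E fin by (subst card_SigmaI) (auto simp: W_def)
  \<comment> \<open>The pair \<open>(\<alpha>, u)\<close> goes to \<open>(u, u / \<alpha>)\<close>,
    with inverse \<open>(u, v)\<close> to \<open>(u / v, u)\<close>. The quotient stays in
    \<open>K(\<lambda>)\<close> because \<open>m \<le> t\<close> puts \<open>P m\<close> inside
    it.\<close>
  also have "\<dots> = card ((P m - {\<zero>}) \<times> (P m - {\<zero>}))"
  proof (rule bij_betw_same_card, rule bij_betwI)
    show "(\<lambda>(\<alpha>, u). (u, inv \<alpha> \<otimes> u))
        \<in> (SIGMA \<alpha>:E - {\<zero>}. W \<alpha> m - {\<zero>}) \<rightarrow> (P m - {\<zero>}) \<times> (P m - {\<zero>})"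
    proof
      fix x assume "x \<in> (SIGMA \<alpha>:E - {\<zero>}. W \<alpha> m - {\<zero>})"
      then obtain \<alpha> u where x: "x = (\<alpha>, u)" and \<alpha>: "\<alpha> \<in> E" "\<alpha> \<noteq> \<zero>"
          and u: "u \<in> W \<alpha> m" "u \<noteq> \<zero>"
        by auto
      then obtain v where v: "v \<in> P m" "u = \<alpha> \<otimes> v" "u \<in> P m"
        by (auto simp: mem_W_iff)
      have c: "\<alpha> \<in> carrier R" "v \<in> carrier R" "\<alpha> \<in> Units R"
        using \<alpha> v E_carrier P_carrier field_Units by auto
      then have "inv \<alpha> \<otimes> u = v"
        using v(2) by (simp add: m_assoc[symmetric])
      moreover have "v \<noteq> \<zero>"
        using u(2) v(2) c by auto
      ultimately show "(case x of (\<alpha>, u) \<Rightarrow> (u, inv \<alpha> \<otimes> u)) \<in> (P m - {\<zero>}) \<times> (P m - {\<zero>})"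
        using x u v by simp
    qed
    show "(\<lambda>(u, v). (u \<otimes> inv v, u))
        \<in> (P m - {\<zero>}) \<times> (P m - {\<zero>}) \<rightarrow> (SIGMA \<alpha>:E - {\<zero>}. W \<alpha> m - {\<zero>})"
    proof
      fix y assume "y \<in> (P m - {\<zero>}) \<times> (P m - {\<zero>})"
      then obtain u v where y: "y = (u, v)" and u: "u \<in> P m" "u \<noteq> \<zero>" and v: "v \<in> P m" "v \<noteq> \<zero>"
        by auto
      then have E: "u \<in> E" "v \<in> E - {\<zero>}"
        using P_mono[OF assms] by (auto simp: P_t)
      have c: "u \<in> carrier R" "v \<in> carrier R" "v \<in> Units R"
        using u v P_carrier field_Units by auto
      have "u \<otimes> inv v \<in> E"
        using E subfield_m_inv(1)[OF subfield_E] subringE(6)[OF subfieldE(1)[OF subfield_E]] by blast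
      moreover have eq: "u \<otimes> inv v \<otimes> v = u"
        using c by (simp add: m_assoc)
      moreover have "u \<otimes> inv v \<noteq> \<zero>"
        using eq c u(2) by auto
      moreover have "u \<in> W (u \<otimes> inv v) m"
        using eq u v unfolding mem_W_iff by metis
      ultimately show "(case y of (u, v) \<Rightarrow> (u \<otimes> inv v, u)) \<in> (SIGMA \<alpha>:E - {\<zero>}. W \<alpha> m - {\<zero>})"
        using y u by simp
    qed
  next
    fix x assume "x \<in> (SIGMA \<alpha>:E - {\<zero>}. W \<alpha> m - {\<zero>})"
    then obtain \<alpha> u where x: "x = (\<alpha>, u)" "\<alpha> \<in> E" "\<alpha> \<noteq> \<zero>" "u \<in> P m" "u \<noteq> \<zero>"
      by (auto simp: W_def)
    then have c: "\<alpha> \<in> carrier R" "u \<in> carrier R" "\<alpha> \<in> Units R" "u \<in> Units R"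
      using E_carrier P_carrier field_Units by auto
    then have "inv (inv \<alpha> \<otimes> u) = \<alpha> \<otimes> inv u"
      by (simp add: inv_mult_Units)
    then have "u \<otimes> inv (inv \<alpha> \<otimes> u) = \<alpha>"
      using c by (simp add: m_lcomm)
    then show "(case case x of (\<alpha>, u) \<Rightarrow> (u, inv \<alpha> \<otimes> u) of (u, v) \<Rightarrow> (u \<otimes> inv v, u)) = x"
      using x by simp
  next
    fix y assume "y \<in> (P m - {\<zero>}) \<times> (P m - {\<zero>})"
    then obtain u v where y: "y = (u, v)" "u \<in> P m" "u \<noteq> \<zero>" "v \<in> P m" "v \<noteq> \<zero>"
      by auto
    then have c: "v \<in> carrier R" "u \<in> carrier R" "v \<in> Units R" "u \<in> Units R"
      using P_carrier field_Units by auto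
    then have "inv (u \<otimes> inv v) = inv u \<otimes> v"
      by (simp add: inv_mult_Units)
    then have "inv (u \<otimes> inv v) \<otimes> u = v"
      using c by (simp add: m_comm[of "inv u \<otimes> v"] m_assoc[symmetric])
    then show "(case case y of (u, v) \<Rightarrow> (u \<otimes> inv v, u) of (\<alpha>, u) \<Rightarrow> (u, inv \<alpha> \<otimes> u)) = y"
      using y by simp
  qed
  also have "\<dots> = (card K ^ m - 1)\<^sup>2"
    using card_dimension[OF subfield finite_K dimension_P[OF assms]] zero_P[of m]
    by (simp add: card_cartesian_product card_Diff_singleton power2_eq_square)
  finally show ?thesis .
qed

text \<open>For \<open>m = j\<close> and \<open>m = Suc j\<close> the bound on \<open>j\<close>
  makes \<open>2 * m - t\<close> zero, so \<open>w \<alpha> m = m - level \<alpha>\<close> and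
  \<open>sum_card_W\<close> becomes a sum of powers of \<open>q\<close> with truncated
  exponents.\<close>

lemma card_level_le:
  assumes "2 * Suc j \<le> t"
  shows "card {\<alpha> \<in> E - {\<zero>}. level \<alpha> \<le> j} = card K ^ (2 * j + 1) - 1"
proof -
  define q where "q = int (card K)"
  have q: "q > 1"
    using card_K_gt_1 by (simp add: q_def)
  have sum: "(\<Sum>\<alpha>\<in>E - {\<zero>}. q ^ (m - level \<alpha>) - 1) = (q ^ m - 1)\<^sup>2" if m: "2 * m \<le> t" for m
  proof -
    have "q ^ (m - level \<alpha>) - 1 = int (card (W \<alpha> m) - 1)" if \<alpha>: "\<alpha> \<in> E - {\<zero>}" for \<alpha>
    proof -
      have "card (W \<alpha> m) = card K ^ (m - level \<alpha>)"
        using card_W[of \<alpha> m] w_eq_level[OF \<alpha>, of m] \<alpha> E_carrier m by auto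
      then show ?thesis
        using card_K_gt_1 by (simp add: q_def of_nat_diff)
    qed
    then have "(\<Sum>\<alpha>\<in>E - {\<zero>}. q ^ (m - level \<alpha>) - 1) = int (\<Sum>\<alpha>\<in>E - {\<zero>}. card (W \<alpha> m) - 1)"
      by simp
    also have "\<dots> = (q ^ m - 1)\<^sup>2"
      using sum_card_W[of m] m card_K_gt_1 by (simp add: q_def of_nat_diff)
    finally show ?thesis .
  qed
  have "(q - 1) * int (card {\<alpha> \<in> E - {\<zero>}. level \<alpha> \<le> j})
      = (\<Sum>\<alpha>\<in>{\<alpha> \<in> E - {\<zero>}. level \<alpha> \<le> j}. q - 1)"
    by simp
  also have "\<dots> = (\<Sum>\<alpha>\<in>E - {\<zero>}. if level \<alpha> \<le> j then q - 1 else 0)"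
    using finite_E by (intro sum.inter_filter) simp
  \<comment> \<open>If \<open>level \<alpha> \<le> j\<close>, the powers cancel and
    \<open>q - 1\<close> remains; otherwise both exponents truncate to 0 and the term
    vanishes.\<close>
  also have "\<dots> = (\<Sum>\<alpha>\<in>E - {\<zero>}. (q ^ (Suc j - level \<alpha>) - 1) - q * (q ^ (j - level \<alpha>) - 1))"
    by (intro sum.cong refl) (auto simp: Suc_diff_le algebra_simps)
  also have "\<dots> = (q ^ Suc j - 1)\<^sup>2 - q * (q ^ j - 1)\<^sup>2"
    using sum[of j] sum[of "Suc j"] assms by (simp add: sum_subtractf sum_distrib_left[symmetric])
  \<comment> \<open>The cross terms of the two squares cancel.\<close>
  also have "\<dots> = (q - 1) * (q ^ (2 * j + 1) - 1)"
  proof -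
    have eq: "q ^ (2 * j + 1) = q * (q ^ j * q ^ j)"
      by (simp add: mult_2 power_add)
    show ?thesis
      unfolding eq by (simp add: power2_eq_square algebra_simps)
  qed
  finally have "int (card {\<alpha> \<in> E - {\<zero>}. level \<alpha> \<le> j}) = q ^ (2 * j + 1) - 1"
    using q by simp
  also have "\<dots> = int (card K ^ (2 * j + 1) - 1)"
    using card_K_gt_1 by (simp add: q_def of_nat_diff)
  finally show ?thesis
    by (simp only: of_nat_eq_iff)
qed

section \<open>Counting the orbit\<close>

text \<open>Both sets have the same finite size, so they agree iff their intersection has dimension
  \<open>k\<close>. As \<open>0 < k < t\<close>, this forces \<alpha> into
  \<open>K(\<lambda>)\<close> with level 0, and the count is the case \<open>j = 0\<close> of
  \<open>card_level_le\<close>.\<close>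

lemma card_l_coset_eq_self:
  assumes "0 < k" and "k < t"
  shows "card {\<beta> \<in> carrier R - {\<zero>}. \<beta> <#\<^bsub>R\<^esub> P k = P k} = card K - 1"
proof -
  have "\<beta> <#\<^bsub>R\<^esub> P k = P k \<longleftrightarrow> \<beta> \<in> E \<and> level \<beta> \<le> 0" if \<beta>: "\<beta> \<in> carrier R - {\<zero>}" for \<beta>
  proof -
    have "card (P k) = card (\<beta> <#\<^bsub>R\<^esub> P k)"
      using card_dimension[OF subfield finite_K dimension_P[of k]]
        card_dimension[OF subfield finite_K dimension_l_coset[OF subfield \<beta> dimension_P[of k]]]
        assms(2) by simp
    moreover have fin: "finite (P k)" "finite (\<beta> <#\<^bsub>R\<^esub> P k)"
      using finite_subset[OF P_carrier finite_carrier] by (auto simp: l_coset_def)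
    ultimately have "\<beta> <#\<^bsub>R\<^esub> P k = P k \<longleftrightarrow> card (W \<beta> k) = card (P k)"
      using card_subset_eq[OF fin(1), of "W \<beta> k"] card_subset_eq[OF fin(2), of "W \<beta> k"]
      unfolding W_def by auto
    also have "\<dots> \<longleftrightarrow> w \<beta> k = k"
      using card_W[OF \<beta>] card_dimension[OF subfield finite_K dimension_P[of k]] assms(2) card_K_gt_1
      by simp
    also have "\<dots> \<longleftrightarrow> \<beta> \<in> E \<and> level \<beta> \<le> 0"
      using w_outside[of \<beta> k] w_eq_level[of \<beta> k] \<beta> assms by (cases "\<beta> \<in> E") auto
    finally show ?thesis .
  qed
  then have "{\<beta> \<in> carrier R - {\<zero>}. \<beta> <#\<^bsub>R\<^esub> P k = P k} = {\<beta> \<in> E - {\<zero>}. level \<beta> \<le> 0}"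
    using E_carrier by blast
  then show ?thesis
    using card_level_le[of 0] assms by simp
qed

text \<open>Orbit-stabiliser: multipliers are counted instead of subspaces, each subspace arising
  from \<open>card K - 1\<close> of them. The predicate \<open>Q\<close> depends on the subspace
  alone, so it holds on whole fibres.\<close>

lemma card_Orb:
  assumes "0 < k" and "k < t"
  shows "(card K - 1) * card {V \<in> Orb R (P k). Q V} = card {\<alpha> \<in> carrier R - {\<zero>}. Q (\<alpha> <#\<^bsub>R\<^esub> P k)}"
proof -
  let ?A = "{\<alpha> \<in> carrier R - {\<zero>}. Q (\<alpha> <#\<^bsub>R\<^esub> P k)}"
  have "card ?A = (card K - 1) * card ((\<lambda>\<alpha>. \<alpha> <#\<^bsub>R\<^esub> P k) ` ?A)"
  proof (rule card_eq_mult_card_image)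
    fix V assume "V \<in> (\<lambda>\<alpha>. \<alpha> <#\<^bsub>R\<^esub> P k) ` ?A"
    then obtain \<alpha> where \<alpha>: "\<alpha> \<in> carrier R - {\<zero>}" "Q (\<alpha> <#\<^bsub>R\<^esub> P k)" "V = \<alpha> <#\<^bsub>R\<^esub> P k"
      by blast
    let ?S = "{\<beta> \<in> carrier R - {\<zero>}. \<beta> <#\<^bsub>R\<^esub> P k = P k}"
    have Units: "\<alpha> \<in> Units R"
      using \<alpha>(1) field_Units by blast
    then have inv: "inv \<alpha> \<in> carrier R - {\<zero>}" "inv \<alpha> \<otimes> \<alpha> = \<one>" "\<alpha> \<otimes> inv \<alpha> = \<one>"
      using Units_inv_Units[OF Units] field_Units by auto
    \<comment> \<open>The fibre over \<open>V\<close> is a coset of the stabiliser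
      \<open>?S\<close>.\<close>
    have "{\<beta> \<in> ?A. \<beta> <#\<^bsub>R\<^esub> P k = V} = (\<otimes>) \<alpha> ` ?S"
    proof (intro equalityI subsetI)
      fix \<beta> assume "\<beta> \<in> {\<beta> \<in> ?A. \<beta> <#\<^bsub>R\<^esub> P k = V}"
      then have \<beta>: "\<beta> \<in> carrier R - {\<zero>}" "\<beta> <#\<^bsub>R\<^esub> P k = \<alpha> <#\<^bsub>R\<^esub> P k"
        using \<alpha> by auto
      have "(inv \<alpha> \<otimes> \<beta>) <#\<^bsub>R\<^esub> P k = inv \<alpha> <#\<^bsub>R\<^esub> (\<alpha> <#\<^bsub>R\<^esub> P k)"
        using l_coset_l_coset[OF _ _ P_carrier, of "inv \<alpha>" \<beta> k] inv \<beta> by simp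
      also have "\<dots> = \<one> <#\<^bsub>R\<^esub> P k"
        using l_coset_l_coset[OF _ _ P_carrier, of "inv \<alpha>" \<alpha> k] inv \<alpha>(1) by simp
      also have "\<dots> = P k"
        by (rule l_coset_one[OF P_carrier])
      finally have "inv \<alpha> \<otimes> \<beta> \<in> ?S"
        using inv \<beta>(1) integral[of "inv \<alpha>" \<beta>] by auto
      moreover have "\<beta> = \<alpha> \<otimes> (inv \<alpha> \<otimes> \<beta>)"
        using inv \<alpha>(1) \<beta>(1) by (simp add: m_assoc[symmetric])
      ultimately show "\<beta> \<in> (\<otimes>) \<alpha> ` ?S"
        by blast
    next
      fix \<beta> assume "\<beta> \<in> (\<otimes>) \<alpha> ` ?S"
      then obtain \<gamma> where \<gamma>: "\<gamma> \<in> carrier R - {\<zero>}" "\<gamma> <#\<^bsub>R\<^esub> P k = P k" "\<beta> = \<alpha> \<otimes> \<gamma>"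
        by blast
      then have "\<beta> <#\<^bsub>R\<^esub> P k = \<alpha> <#\<^bsub>R\<^esub> P k"
        using l_coset_l_coset[OF _ _ P_carrier, of \<alpha> \<gamma> k] \<alpha>(1) by simp
      then show "\<beta> \<in> {\<beta> \<in> ?A. \<beta> <#\<^bsub>R\<^esub> P k = V}"
        using \<alpha> \<gamma> integral[of \<alpha> \<gamma>] by auto
    qed
    moreover have "inj_on ((\<otimes>) \<alpha>) ?S"
      using \<alpha>(1) m_lcancel unfolding inj_on_def by blast
    ultimately show "card {\<beta> \<in> ?A. \<beta> <#\<^bsub>R\<^esub> P k = V} = card K - 1"
      using card_l_coset_eq_self[OF assms] by (simp add: card_image)
  qed (use finite_carrier in simp)
  moreover have "(\<lambda>\<alpha>. \<alpha> <#\<^bsub>R\<^esub> P k) ` ?A = {V \<in> Orb R (P k). Q V}"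
    by (auto simp: Orb_def)
  ultimately show ?thesis
    by simp
qed

text \<open>Distance \<open>2 * i\<close> means intersection of dimension \<open>k - i\<close>. The
  bounds \<open>w \<alpha> k \<le> k\<close> and \<open>i \<le> k\<close> keep the subtraction
  exact.\<close>

lemma orbit_weight_P:
  assumes "0 < k" and "k < t" and "i \<le> k"
  shows "(card K - 1) * orbit_weight R K k (P k) (2 * i)
    = card {\<alpha> \<in> carrier R - {\<zero>}. w \<alpha> k = k - i}"
proof -
  have "w \<alpha> k \<le> k" if "\<alpha> \<in> carrier R - {\<zero>}" for \<alpha>
    using dim_mono[OF subfield finite_dimension_P finite_dimension_W[OF that], of k k] dim_P[of k] assms(2)
    by (simp add: w_def W_def)
  then have "subspace_dist R K k (P k) (\<alpha> <#\<^bsub>R\<^esub> P k) = int (2 * i) \<longleftrightarrow> w \<alpha> k = k - i"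
    if "\<alpha> \<in> carrier R - {\<zero>}" for \<alpha>
    using that assms(3) unfolding subspace_dist_def w_def W_def by fastforce
  then show ?thesis
    unfolding orbit_weight_def card_Orb[OF assms(1,2)] by (intro arg_cong[of _ _ card] Collect_cong) blast
qed

section \<open>Numbers of multipliers with given level or intersection dimension\<close>

lemma card_level_less:
  assumes "0 < m" and "2 * m \<le> t"
  shows "card {\<alpha> \<in> E - {\<zero>}. level \<alpha> < m} = card K ^ (2 * m - 1) - 1"
proof -
  obtain j where "m = Suc j"
    using assms(1) gr0_implies_Suc by blast
  then show ?thesis
    using card_level_le[of j] assms(2) by (simp add: less_Suc_eq_le)
qed

lemma card_level_eq:
  assumes "0 < i" and "2 * Suc i \<le> t"
  shows "card {\<alpha> \<in> E - {\<zero>}. level \<alpha> = i} = card K ^ (2 * i + 1) - card K ^ (2 * i - 1)"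
proof -
  have "{\<alpha> \<in> E - {\<zero>}. level \<alpha> = i} = {\<alpha> \<in> E - {\<zero>}. level \<alpha> \<le> i} - {\<alpha> \<in> E - {\<zero>}. level \<alpha> < i}"
    by auto
  moreover have "card \<dots> = card {\<alpha> \<in> E - {\<zero>}. level \<alpha> \<le> i} - card {\<alpha> \<in> E - {\<zero>}. level \<alpha> < i}"
    using finite_E by (intro card_Diff_subset) auto
  ultimately show ?thesis
    using card_level_less[of i] card_level_le[of i] assms card_K_gt_1 by simp
qed

lemma card_E: "card E = card K ^ t"
  using card_dimension[OF subfield finite_K dimension_P[of t]] by (simp add: P_t)

lemma card_level_ge:
  assumes "0 < m" and "2 * m \<le> t"
  shows "card {\<alpha> \<in> E - {\<zero>}. m \<le> level \<alpha>} = card K ^ t - card K ^ (2 * m - 1)"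
proof -
  have "{\<alpha> \<in> E - {\<zero>}. m \<le> level \<alpha>} = (E - {\<zero>}) - {\<alpha> \<in> E - {\<zero>}. level \<alpha> < m}"
    by auto
  moreover have "card \<dots> = card (E - {\<zero>}) - card {\<alpha> \<in> E - {\<zero>}. level \<alpha> < m}"
    using finite_E by (intro card_Diff_subset) auto
  moreover have "card (E - {\<zero>}) = card K ^ t - 1"
    using card_E zero_P[of t] by (simp add: P_t card_Diff_singleton)
  ultimately show ?thesis
    using card_level_less[OF assms] card_K_gt_1 by simp
qed

lemma card_outside: "card (carrier R - E) = order R - card K ^ t"
  using card_Diff_subset[OF finite_E E_carrier] card_E by (simp add: order_def)

lemma zero_E: "\<zero> \<in> E"
  using zero_P[of t] by (simp add: P_t)

text \<open>A nonzero intersection confines the multiplier to \<open>K(\<lambda>)\<close>, where the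
  dimension is read off the level; \<open>L\<close> is the resulting condition.\<close>

lemma card_w_eq:
  assumes "c \<noteq> 0" and "k \<le> t" and "\<And>\<alpha>. \<alpha> \<in> E - {\<zero>} \<Longrightarrow> w \<alpha> k = c \<longleftrightarrow> L (level \<alpha>)"
  shows "card {\<alpha> \<in> carrier R - {\<zero>}. w \<alpha> k = c} = card {\<alpha> \<in> E - {\<zero>}. L (level \<alpha>)}"
proof -
  have "w \<alpha> k = c \<longleftrightarrow> \<alpha> \<in> E \<and> L (level \<alpha>)" if "\<alpha> \<in> carrier R - {\<zero>}" for \<alpha>
    using that assms(1,3) w_outside[OF _ assms(2), of \<alpha>] by (cases "\<alpha> \<in> E") auto
  then have "{\<alpha> \<in> carrier R - {\<zero>}. w \<alpha> k = c} = {\<alpha> \<in> E - {\<zero>}. L (level \<alpha>)}"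
    using E_carrier by auto
  then show ?thesis
    by simp
qed

lemma card_w_eq_0:
  assumes "k \<le> t"
  shows "card {\<alpha> \<in> carrier R - {\<zero>}. w \<alpha> k = 0}
    = order R - card K ^ t + card {\<alpha> \<in> E - {\<zero>}. w \<alpha> k = 0}"
proof -
  have "{\<alpha> \<in> carrier R - {\<zero>}. w \<alpha> k = 0} = (carrier R - E) \<union> {\<alpha> \<in> E - {\<zero>}. w \<alpha> k = 0}"
    using w_outside[OF _ assms] E_carrier zero_E by blast
  then show ?thesis
    using finite_E finite_carrier card_outside by (simp add: card_Un_disjoint disjoint_iff)
qed

section \<open>The weights, one range of \<open>i\<close> at a time\<close>

lemma orbit_weight_less:
  assumes "1 \<le> i" and "i < k" and "k < t" and "i < t - k"
  shows "orbit_weight R K k (P k) (2 * i) = (card K + 1) * card K ^ (2 * i - 1)"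
proof -
  obtain j where j: "i = Suc j"
    using assms(1) by (cases i) auto
  \<comment> \<open>Since \<open>k - i\<close> is positive and exceeds \<open>2 * k - t\<close>, the
    maximum can equal it only through \<open>k - level \<alpha>\<close>.\<close>
  have "card {\<alpha> \<in> carrier R - {\<zero>}. w \<alpha> k = k - i} = card {\<alpha> \<in> E - {\<zero>}. level \<alpha> = i}"
    using assms w_eq_level[of _ k] by (intro card_w_eq) auto
  \<comment> \<open>Adding \<open>Suc i \<le> k\<close> and \<open>Suc i \<le> t - k\<close> gives
    the bound \<open>2 * Suc i \<le> t\<close>.\<close>
  also have "\<dots> = card K ^ (2 * i + 1) - card K ^ (2 * i - 1)"
    using assms by (intro card_level_eq) auto
  also have "\<dots> = (card K - 1) * ((card K + 1) * card K ^ (2 * i - 1))"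
    using card_K_gt_1 by (simp add: j algebra_simps)
  finally show ?thesis
    using orbit_weight_P[of k i] assms card_K_gt_1 by simp
qed

lemma order_ge: "card K ^ t \<le> order R"
  using card_mono[OF finite_carrier E_carrier] by (simp add: card_E order_def)

text \<open>Here \<open>w \<alpha> k\<close> is \<open>k - level \<alpha>\<close> on
  \<open>K(\<lambda>)\<close>, zero from level \<open>k\<close> on. With the multipliers outside
  \<open>K(\<lambda>)\<close>, the powers \<open>card K ^ t\<close> cancel.\<close>

lemma orbit_weight_small_top:
  assumes "0 < k" and "2 * k \<le> t"
  shows "(card K - 1) * orbit_weight R K k (P k) (2 * k) = order R - card K ^ (2 * k - 1)"
proof -
  have le: "card K ^ (2 * k - 1) \<le> card K ^ t"
    using assms card_K_gt_1 by (intro power_increasing) auto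
  have "{\<alpha> \<in> E - {\<zero>}. w \<alpha> k = 0} = {\<alpha> \<in> E - {\<zero>}. k \<le> level \<alpha>}"
    using w_eq_level[of _ k] assms by auto
  then show ?thesis
    using orbit_weight_P[of k k] card_w_eq_0[of k] card_level_ge[of k] assms order_ge le by simp
qed

text \<open>The dimension \<open>2 * k - t\<close> is the least one possible within
  \<open>K(\<lambda>)\<close>; every level from \<open>t - k\<close> on attains it, so a whole tail
  of levels is counted.\<close>

lemma orbit_weight_large_middle:
  assumes "0 < k" and "k < t" and "t < 2 * k"
  shows "(card K - 1) * orbit_weight R K k (P k) (2 * (t - k))
    = card K ^ t - card K ^ (2 * (t - k) - 1)"
proof -
  have "card {\<alpha> \<in> carrier R - {\<zero>}. w \<alpha> k = k - (t - k)}
      = card {\<alpha> \<in> E - {\<zero>}. t - k \<le> level \<alpha>}"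
    using assms w_eq_level[of _ k] by (intro card_w_eq) auto
  then show ?thesis
    using orbit_weight_P[of k "t - k"] card_level_ge[of "t - k"] assms by simp
qed

text \<open>The dimension \<open>k - i\<close> is below the minimum \<open>2 * k - t\<close> on
  \<open>K(\<lambda>)\<close>, yet not 0, the value outside.\<close>

lemma orbit_weight_large_zero:
  assumes "0 < k" and "k < t" and "t - k < i" and "i < k"
  shows "orbit_weight R K k (P k) (2 * i) = 0"
proof -
  have "card {\<alpha> \<in> carrier R - {\<zero>}. w \<alpha> k = k - i} = card {\<alpha> \<in> E - {\<zero>}. False}"
    using assms w_eq_level[of _ k] by (intro card_w_eq) auto
  then show ?thesis
    using orbit_weight_P[of k i] assms card_K_gt_1 by simp
qed

text \<open>On \<open>K(\<lambda>)\<close> the intersection has dimension at least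
  \<open>2 * k - t > 0\<close>, so exactly the multipliers outside it reach distance
  \<open>2 * k\<close>.\<close>

lemma orbit_weight_large_top:
  assumes "0 < k" and "k < t" and "t < 2 * k"
  shows "(card K - 1) * orbit_weight R K k (P k) (2 * k) = order R - card K ^ t"
proof -
  have "w \<alpha> k \<noteq> 0" if "\<alpha> \<in> E - {\<zero>}" for \<alpha>
    using w_eq_level[OF that, of k] assms by simp
  then have empty: "{\<alpha> \<in> E - {\<zero>}. w \<alpha> k = 0} = {}"
    by blast
  show ?thesis
    using orbit_weight_P[of k k] card_w_eq_0[of k, unfolded empty] assms by simp
qed

end

theorem theorem4p4:
  fixes R :: "('a, 'b) ring_scheme" (structure)
    and K S :: "'a set" and lam :: 'a and q n t k :: nat
  assumes "primepow q"
    and "field R" and "order R = q ^ n"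
    and "subfield K R" and "card K = q"
    and "lam \<in> carrier R - K"
    and "t = (ring.dim R over K) (generate_field R (insert lam K))"
    and "S = ring.Span R K (map (\<lambda>j::nat. lam [^] j) [0..<k])"
    and "1 < k" and "k < t"
  shows "(real k \<le> real t / 2 \<longrightarrow>
            (\<forall>i \<in> {1..k-1}.
               real (orbit_weight R K k S (2*i)) = (real q + 1) * real q ^ (2*i-1)) \<and>
            real (orbit_weight R K k S (2*k)) = (real q ^ n - real q ^ (2*k-1)) / (real q - 1))
       \<and> (real k > real t / 2 \<longrightarrow>
            (\<forall>i \<in> {1..t-k-1}.
               real (orbit_weight R K k S (2*i)) = (real q + 1) * real q ^ (2*i-1)) \<and>
            real (orbit_weight R K k S (2*(t-k))) =
               (real q ^ t - real q ^ (2*(t-k)-1)) / (real q - 1) \<and>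
            (\<forall>i \<in> {t-k+1..k-1}. t-k+1 \<noteq> k \<longrightarrow> orbit_weight R K k S (2*i) = 0) \<and>
            real (orbit_weight R K k S (2*k)) = (real q ^ n - real q ^ t) / (real q - 1))"
proof -
  interpret field R
    by (rule assms(2))
  have "0 < q"
    using primepow_gt_Suc_0[OF assms(1)] by simp
  \<comment> \<open>\<open>order\<close> is a \<open>card\<close>, hence 0 for an infinite carrier,
    while \<open>q ^ n\<close> is positive.\<close>
  then have "finite (carrier R)"
    using assms(3) card_ge_0_finite[of "carrier R"] by (simp add: order_def)
  then interpret F: power_flag R K lam
    using assms(4,6) by (intro power_flag.intro power_flag_axioms.intro field_axioms)
  have t: "F.t = t"
    using simple_extension_dim[OF F.subfield F.lam_carrier(1) F.algebraic_lam]
    by (simp add: assms(7) F.t_def F.E_eq_generate_field)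
  \<comment> \<open>The powers come in opposite orders, but a span depends only on the set of
    generators.\<close>
  have S: "S = F.P k"
    unfolding assms(8) F.P_def
    by (rule Span_same_set[OF F.subfield]) (use F.lam_carrier in \<open>auto simp: exp_base_def\<close>)
  have q: "card K = q" "1 < q"
    using assms(5) F.card_K_gt_1 by auto
  have le: "q ^ t \<le> q ^ n"
    using F.order_ge assms(3) t q by simp
  have pow_le: "q ^ (2 * j - 1) \<le> q ^ t" if "2 * j \<le> t" for j
    using that q by (intro power_increasing) auto
  \<comment> \<open>Serves both cases: \<open>i < k\<close> implies \<open>i < t - k\<close> if
    \<open>2 * k \<le> t\<close>, and \<open>i < t - k\<close> implies \<open>i < k\<close> if
    \<open>t < 2 * k\<close>.\<close>
  have low: "real (orbit_weight R K k S (2 * i)) = (real q + 1) * real q ^ (2 * i - 1)"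
    if "1 \<le> i" "i < k" "i < t - k" for i
    using F.orbit_weight_less[of i k] that assms(10) by (simp add: S t q algebra_simps)
  show ?thesis
  proof (intro conjI impI)
    assume "real k \<le> real t / 2"
    then have k: "2 * k \<le> t"
      by linarith
    then show "\<forall>i\<in>{1..k-1}. real (orbit_weight R K k S (2 * i)) = (real q + 1) * real q ^ (2 * i - 1)"
      using low assms(9) by auto
    show "real (orbit_weight R K k S (2 * k)) = (real q ^ n - real q ^ (2 * k - 1)) / (real q - 1)"
      using real_eq_diff_divide[OF q(2), of "orbit_weight R K k S (2 * k)" "q ^ n" "q ^ (2 * k - 1)"]
        F.orbit_weight_small_top[of k] le pow_le[of k] k assms(3,9) by (simp add: S t q)
  next
    assume "real k > real t / 2"
    then have k: "t < 2 * k"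
      by linarith
    show "\<forall>i\<in>{1..t-k-1}. real (orbit_weight R K k S (2 * i)) = (real q + 1) * real q ^ (2 * i - 1)"
      using low k assms(10) by auto
    show "real (orbit_weight R K k S (2 * (t - k))) = (real q ^ t - real q ^ (2 * (t - k) - 1)) / (real q - 1)"
      using real_eq_diff_divide[OF q(2), of "orbit_weight R K k S (2 * (t - k))" "q ^ t" "q ^ (2 * (t - k) - 1)"]
        F.orbit_weight_large_middle[of k] pow_le[of "t - k"] k assms(9,10) by (simp add: S t q)
    show "\<forall>i\<in>{t-k+1..k-1}. t - k + 1 \<noteq> k \<longrightarrow> orbit_weight R K k S (2 * i) = 0"
      using F.orbit_weight_large_zero[of k] assms(9,10) by (auto simp: S t)
    show "real (orbit_weight R K k S (2 * k)) = (real q ^ n - real q ^ t) / (real q - 1)"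
      using real_eq_diff_divide[OF q(2), of "orbit_weight R K k S (2 * k)" "q ^ n" "q ^ t"]
        F.orbit_weight_large_top[of k] le k assms(3,9,10) by (simp add: S t q)
  qed
qed

end
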